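(* Let $0<q<1$, let $f(z)=z+\sum_{n=2}^\infty a_nz^n\in\mathcal{S}_q$, and let $\mu$ be any complex number. Then $$|a_3-\mu a_2^2|\le\max\left\{\left|\frac{2(2+q)-4\mu(1+q)}{q^2(1+q)}\right|,\ \frac{2}{q(1+q)}\right\}.$$ Equality occurs for the functions $F,G\in\mathcal{A}$ satisfying $$\frac{z(D_qF)(z)}{F(z)}=\frac{1+z}{1-z}\qquad\text{and}\qquad\frac{z(D_qG)(z)}{G(z)}=\frac{1+z^2}{1-z^2}.$$
   Context: Let $\mathbb{D}=\{z\in\mathbb{C}:|z|<1\}$ and let $\mathcal{A}$ be the class of functions $f$ analytic in $\mathbb{D}$ with $f(0)=0$ and $f'(0)=1$. For $0<q<1$ the $q$-difference operator is $(D_qf)(z)=\frac{f(z)-f(qz)}{z(1-q)}$ for $z\ne0$, and $(D_qf)(0)=f'(0)$. The class $\mathcal{S}_q$ consists of all $f\in\mathcal{A}$ with $\operatorname{Re}\left(\frac{z(D_qf)(z)}{f(z)}\right)>0$ for all $z\in\mathbb{D}$.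
   Formalization: No F, G in A solve these equations on all of D (a zero at qz₀, with z₀ or z₀² equal to q/(2−q), forces the zero function), so equality is stated for normalized solutions on |z|<r, 0<r≤1, which exist for some r: F attains the first term of the max, G the second. *)

theory Defs
  imports "HOL-Complex_Analysis.Complex_Analysis"
begin

text \<open>
  Analytic functions on the disc of radius \<open>r\<close> about the origin, with the usual normalization.
  Values outside that disc are irrelevant.
\<close>
definition normalized_on :: "real \<Rightarrow> (complex \<Rightarrow> complex) set" where
  "normalized_on r = {f. f holomorphic_on ball 0 r \<and> f 0 = 0 \<and> deriv f 0 = 1}"

definition class_A :: "(complex \<Rightarrow> complex) set" where
  "class_A = normalized_on 1"

definition q_diff :: "real \<Rightarrow> (complex \<Rightarrow> complex) \<Rightarrow> complex \<Rightarrow> complex" where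
  "q_diff q f z =
     (if z = 0 then deriv f 0
      else (f z - f (of_real q * z)) / (z * (1 - of_real q)))"

text \<open>
  The quotient \<open>z (D\<^sub>q f)(z) / f(z)\<close>.  For normalized \<open>f\<close> it has a removable singularity at the
  origin with value \<open>1\<close>, whereas division by zero in HOL would give \<open>0\<close> there.
\<close>
definition q_quot :: "real \<Rightarrow> (complex \<Rightarrow> complex) \<Rightarrow> complex \<Rightarrow> complex" where
  "q_quot q f z = (if z = 0 then 1 else z * q_diff q f z / f z)"

text \<open>
  Since \<open>x / 0 = 0\<close>, positivity of the real part forces \<open>f z \<noteq> 0\<close> for \<open>z \<noteq> 0\<close>, i.e. the quotient
  is genuinely defined on the punctured disc.
\<close>
definition class_S :: "real \<Rightarrow> (complex \<Rightarrow> complex) set" where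
  "class_S q = {f \<in> class_A. \<forall>z\<in>ball 0 1. Re (q_quot q f z) > 0}"

definition taylor_coeff :: "(complex \<Rightarrow> complex) \<Rightarrow> nat \<Rightarrow> complex" where
  "taylor_coeff f n = fps_nth (fps_expansion f 0) n"

text \<open>
  \<open>f\<close> is normalized and satisfies \<open>z (D\<^sub>q f)(z) / f(z) = p(z)\<close> on the disc of radius \<open>r\<close>;
  for \<open>r = 1\<close> this says that \<open>f\<close> lies in \<open>class_A\<close> and solves the equation on the unit disc.
  The radius is a parameter because for \<open>p(z) = (1 + z) / (1 - z)\<close> and
  \<open>p(z) = (1 + z\<^sup>2) / (1 - z\<^sup>2)\<close> the equation has an analytic solution near the origin, but
  none on the whole unit disc: it reads \<open>f(q z) = (1 - (1 - q) p(z)) f(z)\<close>, and \<open>p\<close> takes the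
  value \<open>1 / (1 - q)\<close> at a point of the disc (\<open>z = q / (2 - q)\<close> in the first case).
\<close>
definition q_quot_solution ::
    "real \<Rightarrow> real \<Rightarrow> (complex \<Rightarrow> complex) \<Rightarrow> (complex \<Rightarrow> complex) \<Rightarrow> bool" where
  "q_quot_solution q r p f \<longleftrightarrow>
     f \<in> normalized_on r \<and> (\<forall>z\<in>ball 0 r. q_quot q f z = p z)"

end

theory Submission
  imports Defs
begin

text \<open>
  Writing \<open>p = 1 + p\<^sub>1 z + p\<^sub>2 z\<^sup>2 + \<dots>\<close> for the quotient, comparing coefficients in
  \<open>f(z) - f(q z) = (1 - q) p(z) f(z)\<close> gives \<open>a\<^sub>2 = p\<^sub>1 / q\<close> and
  \<open>a\<^sub>3 = (p\<^sub>2 + p\<^sub>1\<^sup>2 / q) / (q (1 + q))\<close>.  Hence \<open>a\<^sub>3 - \<mu> a\<^sub>2\<^sup>2\<close> is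
  \<open>(p\<^sub>2 - \<nu> p\<^sub>1\<^sup>2) / (q (1 + q))\<close> with \<open>\<nu> = (\<mu> (1 + q) - 1) / q\<close>, and for functions of
  positive real part \<open>\<bar>p\<^sub>2 - \<nu> p\<^sub>1\<^sup>2\<bar> \<le> 2 max {1, \<bar>2 \<nu> - 1\<bar>}\<close>, by the Schwarz-Pick
  inequality applied to the Cayley transform of \<open>p\<close>.  The extremal functions are
  \<open>z g(z\<^sup>m)\<close> for \<open>m = 1, 2\<close>, with \<open>g\<close> a \<open>q\<^sup>m\<close>-binomial series.
\<close>

section \<open>The Schwarz-Pick inequality at the origin\<close>

text \<open>The identity |1 - cnj a * z|^2 - |z - a|^2 = (1 - |a|^2) (1 - |z|^2) gives the norm
  bound.\<close>

lemma moebius_norm_less_1: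
  fixes a z :: complex
  assumes "cmod a < 1" and "cmod z < 1"
  shows "1 - cnj a * z \<noteq> 0" and "cmod ((z - a) / (1 - cnj a * z)) < 1"
proof -
  have "cmod (cnj a * z) < 1"
    using mult_strict_mono'[OF assms] by (simp add: norm_mult)
  then show nz: "1 - cnj a * z \<noteq> 0"
    by auto
  have "(cmod (1 - cnj a * z))\<^sup>2 - (cmod (z - a))\<^sup>2 = (1 - (cmod a)\<^sup>2) * (1 - (cmod z)\<^sup>2)"
    unfolding cmod_power2 by (simp add: power2_eq_square algebra_simps)
  moreover have "\<dots> > 0"
    using assms by (intro mult_pos_pos) (simp_all add: power_less_one_iff)
  ultimately have "(cmod (z - a))\<^sup>2 < (cmod (1 - cnj a * z))\<^sup>2"
    by simp
  then have "cmod (z - a) < cmod (1 - cnj a * z)"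
    by (rule power_less_imp_less_base) simp
  then show "cmod ((z - a) / (1 - cnj a * z)) < 1"
    using nz by (simp add: norm_divide)
qed

text \<open>Following \<open>h\<close> by the disc automorphism that sends \<open>h 0\<close> to 0
  makes the Schwarz lemma applicable. The composition has derivative \<open>deriv h 0\<close> / (1 -
  |h 0|^2) at 0.\<close>

lemma Schwarz_Pick_at_0:
  assumes hol: "h holomorphic_on ball 0 1" and less: "\<And>z. cmod z < 1 \<Longrightarrow> cmod (h z) < 1"
  shows "cmod (deriv h 0) \<le> 1 - (cmod (h 0))\<^sup>2"
proof -
  define a where "a = h 0"
  define \<psi> where "\<psi> z = (h z - a) / (1 - cnj a * h z)" for z
  have a: "cmod a < 1"
    using less[of 0] by (simp add: a_def)
  have nz: "1 - cnj a * h z \<noteq> 0" if "cmod z < 1" for z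
    using moebius_norm_less_1(1)[OF a less[OF that]] .
  have "\<psi> holomorphic_on ball 0 1"
    unfolding \<psi>_def using nz by (intro holomorphic_intros hol) auto
  moreover have "\<psi> 0 = 0"
    by (simp add: \<psi>_def a_def)
  moreover have "cmod (\<psi> z) < 1" if "cmod z < 1" for z
    unfolding \<psi>_def by (rule moebius_norm_less_1(2)[OF a less[OF that]])
  ultimately have d\<psi>: "cmod (deriv \<psi> 0) \<le> 1"
    using Schwarz_Lemma(2)[of \<psi> 0] by simp
  have h': "(h has_field_derivative deriv h 0) (at 0)"
    using hol by (intro holomorphic_derivI[of _ "ball 0 1"]) auto
  have "(\<psi> has_field_derivative
      (deriv h 0 * (1 - cnj a * h 0) - (h 0 - a) * (- (cnj a * deriv h 0)))
        / ((1 - cnj a * h 0) * (1 - cnj a * h 0))) (at 0)"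
    unfolding \<psi>_def using nz[of 0] by (auto intro!: derivative_eq_intros h')
  then have "deriv \<psi> 0 = deriv h 0 / (1 - cnj a * a)"
    using nz[of 0] by (auto dest!: DERIV_imp_deriv simp: a_def divide_simps)
  also have "cnj a * a = of_real ((cmod a)\<^sup>2)"
    by (metis complex_norm_square mult.commute)
  also have "1 - complex_of_real ((cmod a)\<^sup>2) = of_real (1 - (cmod a)\<^sup>2)"
    by simp
  finally have "cmod (deriv \<psi> 0) = cmod (deriv h 0) / \<bar>1 - (cmod a)\<^sup>2\<bar>"
    by (simp only: norm_divide norm_of_real)
  moreover have "1 - (cmod a)\<^sup>2 > 0"
    using a by (simp add: power_less_one_iff)
  ultimately show ?thesis
    using d\<psi> by (simp add: a_def pos_divide_le_eq)
qed

text \<open>Here \<open>h\<close> is w(z)/z with its singularity removed. Either the Schwarz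
  inequality is strict, so \<open>h\<close> maps into the open disc and Schwarz-Pick applies, or
  \<open>w\<close> is a rotation, \<open>h\<close> is a unimodular constant and both sides of the
  bound are 0.\<close>

lemma Schwarz_quotient_coeff_bound:
  assumes hol: "w holomorphic_on ball 0 1" and "w 0 = 0"
    and less: "\<And>z. cmod z < 1 \<Longrightarrow> cmod (w z) < 1"
  obtains h where "h holomorphic_on ball 0 1" and "\<And>z. cmod z < 1 \<Longrightarrow> w z = z * h z"
    and "cmod (deriv h 0) \<le> 1 - (cmod (h 0))\<^sup>2"
proof -
  obtain h where h: "h holomorphic_on ball 0 1" "\<And>z. cmod z < 1 \<Longrightarrow> w z = z * h z"
      "deriv w 0 = h 0"
    using Schwarz3[OF hol \<open>w 0 = 0\<close>] by blast
  have "cmod (deriv h 0) \<le> 1 - (cmod (h 0))\<^sup>2"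
  proof (cases "(\<exists>z. cmod z < 1 \<and> z \<noteq> 0 \<and> cmod (w z) = cmod z) \<or> cmod (deriv w 0) = 1")
    case True
    then obtain \<alpha> where \<alpha>: "\<And>z. cmod z < 1 \<Longrightarrow> w z = \<alpha> * z" "cmod \<alpha> = 1"
      using Schwarz_Lemma(3)[OF hol \<open>w 0 = 0\<close> less, of 0] by auto
    have "(w has_field_derivative \<alpha>) (at 0)"
    proof (rule DERIV_cong_ev[THEN iffD2, OF refl _ refl])
      show "eventually (\<lambda>z. w z = \<alpha> * z) (nhds 0)"
        using \<alpha>(1) by (auto simp: eventually_nhds_metric intro!: exI[of _ 1])
    qed (auto intro!: derivative_eq_intros)
    then have h0: "h 0 = \<alpha>"
      using h(3) by (simp add: DERIV_imp_deriv)
    \<comment> \<open>Cancelling \<open>z\<close> settles only \<open>z \<noteq> 0\<close>; the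
      value at 0 comes from the derivative of \<open>w\<close>.\<close>
    have "h z = \<alpha>" if "cmod z < 1" for z
      using h(2)[OF that] \<alpha>(1)[OF that] h0 by (cases "z = 0") auto
    then have "eventually (\<lambda>z. h z = \<alpha>) (nhds 0)"
      by (auto simp: eventually_nhds_metric intro!: exI[of _ 1])
    then have "deriv h 0 = deriv (\<lambda>_. \<alpha>) 0"
      by (intro deriv_cong_ev) auto
    then show ?thesis
      using \<alpha>(2) h0 by simp
  next
    case False
    have "cmod (h z) < 1" if z: "cmod z < 1" for z
    proof (cases "z = 0")
      case True
      with False h(3) Schwarz_Lemma(2)[OF hol \<open>w 0 = 0\<close> less, of 0] show ?thesis
        by auto
    next
      case nz: False
      have "cmod (w z) < cmod z"
        using False Schwarz_Lemma(1)[OF hol \<open>w 0 = 0\<close> less z] z nz by force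
      then show ?thesis
        using h(2)[OF z] nz by (simp add: norm_mult)
    qed
    then show ?thesis
      by (rule Schwarz_Pick_at_0[OF h(1)])
  qed
  with h show ?thesis
    using that by blast
qed

section \<open>The Fekete-Szego inequality for positive real part\<close>

text \<open>Turns a functional equation on a small disc into an identity of formal power series,
  ready for comparison of coefficients.\<close>

lemma fps_expansion_unique_on_ball:
  fixes f g :: "complex \<Rightarrow> complex"
  assumes f: "f has_fps_expansion F" and g: "g has_fps_expansion G"
    and "r > 0" and eq: "\<And>z. cmod z < r \<Longrightarrow> f z = g z"
  shows "F = G"
proof -
  have "eventually (\<lambda>z. f z = g z) (nhds 0)"
    using \<open>r > 0\<close> eq by (auto simp: eventually_nhds_metric)
  then have "f has_fps_expansion G"
    using g by (subst has_fps_expansion_cong) auto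
  then show ?thesis
    by (rule fps_expansion_unique_complex[OF f])
qed

text \<open>
  If \<open>(p - 1) / (p + 1) = z h(z)\<close> with \<open>h = c\<^sub>1 + c\<^sub>2 z + \<dots>\<close>, then \<open>p\<^sub>1 = 2 c\<^sub>1\<close> and
  \<open>p\<^sub>2 = 2 c\<^sub>2 + 2 c\<^sub>1\<^sup>2\<close>, so the functional is \<open>2 (c\<^sub>2 - (2 \<nu> - 1) c\<^sub>1\<^sup>2)\<close>.
\<close>
lemma Fekete_Szego_positive_real_part:
  assumes hol: "p holomorphic_on ball 0 1" and "p 0 = 1"
    and pos: "\<And>z. cmod z < 1 \<Longrightarrow> Re (p z) > 0"
    and P: "p has_fps_expansion P"
  shows "cmod (fps_nth P 2 - \<nu> * (fps_nth P 1)\<^sup>2) \<le> 2 * max 1 (cmod (2 * \<nu> - 1))"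
proof -
  define w where "w z = (p z - 1) / (p z + 1)" for z
  have nz: "p z + 1 \<noteq> 0" if "cmod z < 1" for z
    using pos[OF that] by (auto simp: complex_eq_iff)
  have less: "cmod (w z) < 1" if "cmod z < 1" for z
  proof -
    \<comment> \<open>The two squares differ by 4 Re (p z).\<close>
    have "(cmod (p z - 1))\<^sup>2 < (cmod (p z + 1))\<^sup>2"
      using pos[OF that] unfolding cmod_power2 by (simp add: power2_eq_square algebra_simps)
    then have "cmod (p z - 1) < cmod (p z + 1)"
      by (rule power_less_imp_less_base) simp
    then show ?thesis
      using nz[OF that] by (simp add: w_def norm_divide)
  qed
  have "w holomorphic_on ball 0 1"
    unfolding w_def using nz by (intro holomorphic_intros hol) auto
  moreover have "w 0 = 0"
    by (simp add: w_def \<open>p 0 = 1\<close>)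
  ultimately obtain h where h: "h holomorphic_on ball 0 1"
      "\<And>z. cmod z < 1 \<Longrightarrow> w z = z * h z" "cmod (deriv h 0) \<le> 1 - (cmod (h 0))\<^sup>2"
    using Schwarz_quotient_coeff_bound less by blast
  define H where "H = fps_expansion h 0"
  have H: "h has_fps_expansion H"
    unfolding H_def using h(1) by (intro has_fps_expansion_fps_expansion[of "ball 0 1"]) auto
  \<comment> \<open>Cleared of its denominator, w(z) = z h(z) becomes p - 1 = (p + 1) z h, which
    avoids dividing power series.\<close>
  have "(\<lambda>z. p z - 1) has_fps_expansion P - 1"
    by (intro fps_expansion_intros P)
  moreover have "(\<lambda>z. (p z + 1) * (z * h z)) has_fps_expansion (P + 1) * (fps_X * H)"
    by (intro fps_expansion_intros P H)
  ultimately have eq: "P - 1 = (P + 1) * (fps_X * H)"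
  proof (rule fps_expansion_unique_on_ball[of _ _ _ _ 1])
    fix z :: complex
    assume "cmod z < 1"
    from nz[OF this] h(2)[OF this] show "p z - 1 = (p z + 1) * (z * h z)"
      by (simp add: w_def divide_simps)
  qed simp
  have P0: "fps_nth P 0 = 1"
    using fps_nth_fps_expansion[OF P, of 0] \<open>p 0 = 1\<close> by simp
  have P1: "fps_nth P 1 = 2 * fps_nth H 0"
    using arg_cong[OF eq, of "\<lambda>F. fps_nth F 1"] P0 by (simp add: fps_mult_nth)
  have P2: "fps_nth P 2 = 2 * fps_nth H 1 + 2 * (fps_nth H 0)\<^sup>2"
    using arg_cong[OF eq, of "\<lambda>F. fps_nth F 2"] P0 P1
    by (simp add: fps_mult_nth numeral_2_eq_2 algebra_simps)
  define c d where "c = cmod (h 0)" and "d = cmod (deriv h 0)"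
  have cd: "d \<le> 1 - c\<^sup>2"
    using h(3) by (simp add: c_def d_def)
  have nths: "fps_nth H 0 = h 0" "fps_nth H 1 = deriv h 0"
    using fps_nth_fps_expansion[OF H, of 0] fps_nth_fps_expansion[OF H, of 1] by simp_all
  have "fps_nth P 2 - \<nu> * (fps_nth P 1)\<^sup>2 = 2 * (deriv h 0 - (2 * \<nu> - 1) * (h 0)\<^sup>2)"
    unfolding P1 P2 nths by (simp add: algebra_simps power2_eq_square)
  also have "cmod \<dots> \<le> 2 * (d + cmod (2 * \<nu> - 1) * c\<^sup>2)"
    using norm_triangle_ineq4[of "deriv h 0" "(2 * \<nu> - 1) * (h 0)\<^sup>2"]
    unfolding norm_mult[of 2] by (simp add: norm_mult norm_power c_def d_def)
  also have "\<dots> \<le> 2 * max 1 (cmod (2 * \<nu> - 1))"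
  \<comment> \<open>Inserting d \<le> 1 - c^2 leaves a convex combination of 1 and |2 \<nu> - 1|
    with weights 1 - c^2 and c^2.\<close>
  proof -
    have "c\<^sup>2 \<le> 1"
      using cd by (simp add: d_def) (smt (verit) norm_ge_zero)
    then have "(1 - c\<^sup>2) * 1 + c\<^sup>2 * cmod (2 * \<nu> - 1)
        \<le> (1 - c\<^sup>2) * max 1 (cmod (2 * \<nu> - 1)) + c\<^sup>2 * max 1 (cmod (2 * \<nu> - 1))"
      by (intro add_mono mult_left_mono) auto
    also have "\<dots> = max 1 (cmod (2 * \<nu> - 1))"
      by (simp add: algebra_simps)
    finally show ?thesis
      using cd by (simp add: algebra_simps)
  qed
  finally show ?thesis .
qed

section \<open>The q-quotient and the second and third coefficients\<close>

text \<open>With f(z) = z g(z) the factor z cancels, and the quotient becomes (g(z) - q g(qz)) / ((1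
  - q) g(z)), which also takes the prescribed value 1 at the origin.\<close>

lemma q_quot_holomorphic:
  assumes q: "0 < q" "q < 1" and f: "f \<in> class_S q"
  shows "q_quot q f holomorphic_on ball 0 1"
proof -
  have hol: "f holomorphic_on ball 0 1" and f0: "f 0 = 0" and d: "deriv f 0 = 1"
    and pos: "\<And>z. cmod z < 1 \<Longrightarrow> Re (q_quot q f z) > 0"
    using f by (auto simp: class_S_def class_A_def normalized_on_def)
  obtain g where g: "g holomorphic_on ball 0 1" "\<And>z. cmod z < 1 \<Longrightarrow> f z = z * g z"
      "deriv f 0 = g 0"
    using Schwarz3[OF hol f0] by blast
  \<comment> \<open>At 0 the value is \<open>deriv f 0 = 1\<close>. Elsewhere a zero of
    \<open>g\<close> is a zero of \<open>f\<close>, where division by zero makes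
    \<open>q_quot\<close> vanish, against positivity.\<close>
  have nz: "g z \<noteq> 0" if "cmod z < 1" for z
  proof
    assume "g z = 0"
    then have "z \<noteq> 0"
      using g(3) d by auto
    with \<open>g z = 0\<close> g(2)[OF that] pos[OF that] show False
      by (simp add: q_quot_def)
  qed
  have qz: "cmod (of_real q * z) < 1" if "cmod z < 1" for z
    using mult_strict_mono'[of q 1 "cmod z" 1] q that by (simp add: norm_mult)
  have "(\<lambda>z. g (of_real q * z)) holomorphic_on ball 0 1"
    using holomorphic_on_compose_gen[of "\<lambda>z. of_real q * z" "ball 0 1" g "ball 0 1"] g(1) qz
    by (simp add: o_def image_subset_iff holomorphic_intros)
  then have "(\<lambda>z. (g z - of_real q * g (of_real q * z)) / ((1 - of_real q) * g z))
      holomorphic_on ball 0 1"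
    using nz q by (intro holomorphic_intros g(1)) auto
  moreover have "q_quot q f z
      = (g z - of_real q * g (of_real q * z)) / ((1 - of_real q) * g z)"
    if "z \<in> ball 0 1" for z
  proof (cases "z = 0")
    case True
    then show ?thesis
      using q g(3) d by (simp add: q_quot_def)
  next
    case False
    have z: "cmod z < 1"
      using that by simp
    show ?thesis
      using False q nz[OF z] g(2)[OF z] g(2)[OF qz[OF z]]
      by (simp add: q_quot_def q_diff_def divide_simps) (simp add: algebra_simps)
  qed
  ultimately show ?thesis
    using holomorphic_cong by (metis (no_types, lifting))
qed

text \<open>Passing from f(z) to f(qz) multiplies the n-th coefficient by q^n, so the functional
  equation determines the coefficients recursively. The radius is kept general to cover members of
  \<open>class_S\<close> as well as local solutions.\<close>

lemma q_quot_taylor_coeffs: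
  assumes q: "0 < q" "q < 1" and "r > 0" and sol: "q_quot_solution q r p f"
    and nz: "\<forall>z\<in>ball 0 r. p z \<noteq> 0"
    and P: "p has_fps_expansion P"
  shows "taylor_coeff f 2 = fps_nth P 1 / of_real q"
    and "taylor_coeff f 3
           = (fps_nth P 2 + (fps_nth P 1)\<^sup>2 / of_real q) / (of_real q * (1 + of_real q))"
proof -
  have f: "f \<in> normalized_on r" and quot: "\<And>z. z \<in> ball 0 r \<Longrightarrow> q_quot q f z = p z"
    using sol by (auto simp: q_quot_solution_def)
  define F where "F = fps_expansion f 0"
  have F: "f has_fps_expansion F"
    unfolding F_def using f \<open>r > 0\<close>
    by (intro has_fps_expansion_fps_expansion[of "ball 0 r"]) (auto simp: normalized_on_def)
  have f0: "f 0 = 0" and f1: "deriv f 0 = 1"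
    using f by (auto simp: normalized_on_def)
  have F0: "fps_nth F 0 = 0" and F1: "fps_nth F (Suc 0) = 1"
    using fps_nth_fps_expansion[OF F, of 0] fps_nth_fps_expansion[OF F, of 1] f0 f1 by simp_all
  have P0: "fps_nth P 0 = 1"
    using fps_nth_fps_expansion[OF P, of 0] quot[of 0] \<open>r > 0\<close> by (simp add: q_quot_def)
  have "(f \<circ> (\<lambda>z. of_real q * z)) has_fps_expansion (F oo (fps_const (of_real q) * fps_X))"
    by (intro fps_expansion_intros F) auto
  then have "(\<lambda>z. f z - f (of_real q * z)) has_fps_expansion
      (F - (F oo (fps_const (of_real q) * fps_X)))"
    unfolding o_def by (intro fps_expansion_intros F)
  moreover have "(\<lambda>z. (1 - of_real q) * (p z * f z)) has_fps_expansion
      fps_const (1 - of_real q) * (P * F)"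
    by (intro fps_expansion_intros P F)
  ultimately have eq: "F - (F oo (fps_const (of_real q) * fps_X))
      = fps_const (1 - of_real q) * (P * F)"
  proof (rule fps_expansion_unique_on_ball[of _ _ _ _ r])
    fix z :: complex
    assume "cmod z < r"
    then have quot_z: "q_quot q f z = p z" and nz_z: "p z \<noteq> 0"
      using quot nz by auto
    show "f z - f (of_real q * z) = (1 - of_real q) * (p z * f z)"
    proof (cases "z = 0")
      case False
      \<comment> \<open>At a zero of \<open>f\<close> the HOL quotient would be 0, contrary to
        \<open>p z \<noteq> 0\<close>.\<close>
      with quot_z nz_z have "f z \<noteq> 0"
        by (auto simp: q_quot_def)
      with False q show ?thesis
        unfolding quot_z[symmetric] by (simp add: q_quot_def q_diff_def)
    qed (simp add: f0)
  qed (fact \<open>r > 0\<close>)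
  define Q where "Q = complex_of_real q"
  have Q: "Q \<noteq> 0" "1 - Q \<noteq> 0" "1 + Q \<noteq> 0"
    using q by (auto simp: Q_def complex_eq_iff)
  define a b where "a = fps_nth F 2" and "b = fps_nth F 3"
  have coeff: "fps_nth (F - (F oo (fps_const (of_real q) * fps_X))) n
      = (1 - Q ^ n) * fps_nth F n" for n
    by (simp add: Q_def left_diff_distrib)
  \<comment> \<open>The unknown stands on both sides; collecting it leaves the factor (1 - Q) Q. In
    degree 3 the same is done for \<open>b\<close>, with factor (1 - Q) Q (1 + Q).\<close>
  have "(1 - Q\<^sup>2) * a = (1 - Q) * (fps_nth P 1 + a)"
    using arg_cong[OF eq, of "\<lambda>F. fps_nth F 2"] F0 F1 P0 unfolding coeff
    by (simp add: fps_mult_nth numeral_2_eq_2 algebra_simps Q_def a_def)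
  then have "(1 - Q) * (Q * a) = (1 - Q) * fps_nth P 1"
    by algebra
  then have a: "a = fps_nth P 1 / Q"
    using Q by (simp add: nonzero_eq_divide_eq mult.commute)
  then show "taylor_coeff f 2 = fps_nth P 1 / of_real q"
    by (simp add: taylor_coeff_def F_def a_def Q_def)
  have "(1 - Q ^ 3) * b = (1 - Q) * (fps_nth P 2 + fps_nth P 1 * a + b)"
    using arg_cong[OF eq, of "\<lambda>F. fps_nth F 3"] F0 F1 P0 unfolding coeff
    by (simp add: fps_mult_nth numeral_2_eq_2 numeral_3_eq_3 algebra_simps Q_def a_def b_def)
  then have "(1 - Q) * (Q * (1 + Q) * b) = (1 - Q) * (fps_nth P 2 + fps_nth P 1 * a)"
    by algebra
  then have "b = (fps_nth P 2 + fps_nth P 1 * a) / (Q * (1 + Q))"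
    using Q by (simp add: nonzero_eq_divide_eq mult.commute)
  then show "taylor_coeff f 3
      = (fps_nth P 2 + (fps_nth P 1)\<^sup>2 / of_real q) / (of_real q * (1 + of_real q))"
    by (simp add: taylor_coeff_def F_def b_def a Q_def power2_eq_square)
qed

text \<open>Shared by the upper bound and both equality cases. The second identity brings in the
  first entry of the maximum, through 2 \<nu> - 1 = (2 \<mu> (1 + q) - (2 + q)) / q.\<close>

lemma q_quot_Fekete_Szego:
  fixes \<mu> :: complex
  assumes q: "0 < q" "q < 1" and "r > 0" and "q_quot_solution q r p f"
    and "\<forall>z\<in>ball 0 r. p z \<noteq> 0" and "p has_fps_expansion P"
  defines "\<nu> \<equiv> (\<mu> * (1 + of_real q) - 1) / of_real q"
  shows "cmod (taylor_coeff f 3 - \<mu> * (taylor_coeff f 2)\<^sup>2)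
           = cmod (fps_nth P 2 - \<nu> * (fps_nth P 1)\<^sup>2) / (q * (1 + q))"
    and "2 * cmod (2 * \<nu> - 1) / (q * (1 + q))
           = cmod ((2 * (2 + of_real q) - 4 * \<mu> * (1 + of_real q)) /
                     (of_real q ^ 2 * (1 + of_real q)))"
proof -
  have nz: "complex_of_real q \<noteq> 0" "1 + complex_of_real q \<noteq> 0"
    using q by (auto simp: complex_eq_iff)
  have nrm: "cmod (of_real q * (1 + of_real q)) = q * (1 + q)"
    using q by (metis abs_of_pos add_pos_pos mult_pos_pos norm_of_real of_real_1 of_real_add
        of_real_mult zero_less_one)
  have "taylor_coeff f 3 - \<mu> * (taylor_coeff f 2)\<^sup>2
      = (fps_nth P 2 - \<nu> * (fps_nth P 1)\<^sup>2) / (of_real q * (1 + of_real q))"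
    unfolding q_quot_taylor_coeffs[OF assms(1-6)] \<nu>_def
    using nz by (simp add: divide_simps) (simp add: algebra_simps power2_eq_square)
  then show "cmod (taylor_coeff f 3 - \<mu> * (taylor_coeff f 2)\<^sup>2)
      = cmod (fps_nth P 2 - \<nu> * (fps_nth P 1)\<^sup>2) / (q * (1 + q))"
    by (simp only: norm_divide nrm)
  have "(2 * (2 + of_real q) - 4 * \<mu> * (1 + of_real q)) / (of_real q ^ 2 * (1 + of_real q))
      = (- 2) * (2 * \<nu> - 1) / (of_real q * (1 + of_real q))"
    unfolding \<nu>_def using nz
    by (simp add: divide_simps) (simp add: algebra_simps power2_eq_square)
  then show "2 * cmod (2 * \<nu> - 1) / (q * (1 + q))
      = cmod ((2 * (2 + of_real q) - 4 * \<mu> * (1 + of_real q)) /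
                (of_real q ^ 2 * (1 + of_real q)))"
    by (simp only: norm_divide norm_mult[of "-2"] nrm norm_minus_cancel) simp
qed

section \<open>Extremal quotients and their local solutions\<close>

text \<open>The product form \<open>G * P = F\<close> lets the first coefficients of a rational
  function be read off one after another. The condition \<open>g 0 \<noteq> 0\<close> makes
  \<open>G\<close> a unit.\<close>

lemma fps_expansion_of_quotient_eq:
  assumes "f has_fps_expansion F" and "g has_fps_expansion G" and "g 0 \<noteq> 0"
  obtains P where "(\<lambda>z :: complex. f z / g z) has_fps_expansion P" and "G * P = F"
proof
  have "fps_nth G 0 \<noteq> 0"
    using fps_nth_fps_expansion[OF assms(2), of 0] assms(3) by simp
  then show "(\<lambda>z. f z / g z) has_fps_expansion F / G" and "G * (F / G) = F"
    using has_fps_expansion_divide'[OF assms(1,2)] by (auto simp: fps_divide_unit inverse_mult_eq_1')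
qed

text \<open>
  The coefficient recursion \<open>(1 - Q\<^sup>n) g\<^sub>n = (c - Q\<^sup>n\<^sup>-\<^sup>1) g\<^sub>n\<^sub>-\<^sub>1\<close> of the functional equation gives
  \<open>g\<^sub>n = O(K\<^sup>n)\<close> for \<open>K = (c + 1) / (1 - Q)\<close>.
\<close>
lemma q_binomial_functional_equation:
  fixes Q c :: real
  assumes Q: "0 < Q" "Q < 1" and "c \<ge> 0"
  obtains r g where "0 < r" and "r \<le> 1" and "g holomorphic_on ball 0 r" and "g 0 = 1"
    and "\<And>z. z \<in> ball 0 r \<Longrightarrow> g z \<noteq> 0"
    and "\<And>z. z \<in> ball 0 r \<Longrightarrow> (1 - of_real c * z) * g z = (1 - z) * g (of_real Q * z)"
proof -
  define a :: "nat \<Rightarrow> complex"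
    where "a = rec_nat 1 (\<lambda>n x. of_real ((c - Q ^ n) / (1 - Q ^ Suc n)) * x)"
  have a0: "a 0 = 1" and aS: "a (Suc n) = of_real ((c - Q ^ n) / (1 - Q ^ Suc n)) * a n" for n
    by (simp_all add: a_def)
  define K where "K = (c + 1) / (1 - Q)"
  have K: "K > 0"
    using assms by (simp add: K_def)
  have bound: "cmod (a n) \<le> K ^ n" for n
  proof (induction n)
    case (Suc n)
    have "0 \<le> Q ^ n" "Q ^ n \<le> 1" "Q ^ Suc n \<le> Q"
      using Q by (auto simp: power_le_one intro!: mult_left_le)
    then have "\<bar>c - Q ^ n\<bar> \<le> c + 1" "1 - Q \<le> \<bar>1 - Q ^ Suc n\<bar>"
      using \<open>c \<ge> 0\<close> by linarith+
    then have "\<bar>(c - Q ^ n) / (1 - Q ^ Suc n)\<bar> \<le> K"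
      using Q \<open>c \<ge> 0\<close> unfolding K_def abs_divide by (intro frac_le) auto
    then show ?case
      unfolding aS norm_mult norm_of_real power_Suc using Suc K by (intro mult_mono) auto
  qed (simp add: a0)
  define G where "G = Abs_fps a"
  \<comment> \<open>At the point 1 / (2 K) the bound K^n leaves a geometric series of ratio 1/2, so
    the radius of convergence is positive.\<close>
  have "summable (\<lambda>n. a n * of_real (1 / (2 * K)) ^ n)"
  proof (rule summable_comparison_test')
    show "summable (\<lambda>n. (1 / 2) ^ n :: real)"
      by (intro summable_geometric) simp
    show "norm (a n * of_real (1 / (2 * K)) ^ n) \<le> (1 / 2) ^ n" for n
    proof -
      have "norm (a n * of_real (1 / (2 * K)) ^ n) = cmod (a n) * (1 / (2 * K)) ^ n"
        using K by (simp add: norm_mult norm_power norm_divide)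
      also have "\<dots> \<le> K ^ n * (1 / (2 * K)) ^ n"
        using K bound by (intro mult_right_mono) auto
      also have "\<dots> = (1 / 2) ^ n"
        using K by (simp flip: power_mult_distrib)
      finally show ?thesis .
    qed
  qed
  then have "ereal (norm (complex_of_real (1 / (2 * K)))) \<le> fps_conv_radius G"
    unfolding fps_conv_radius_def G_def fps_nth_Abs_fps by (rule conv_radius_geI)
  moreover have "norm (complex_of_real (1 / (2 * K))) > 0"
    using K by simp
  ultimately have "fps_conv_radius G > 0"
    by (metis ereal_less(2) less_le_trans)
  then have G: "eval_fps G has_fps_expansion G"
    by (rule eval_fps_has_fps_expansion)
  then obtain S where S: "open S" "0 \<in> S" "eval_fps G holomorphic_on S"
    by (rule has_fps_expansion_imp_holomorphic)
  have "(eval_fps G \<circ> (\<lambda>z. of_real Q * z)) has_fps_expansion (G oo (fps_const (of_real Q) * fps_X))"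
    by (rule has_fps_expansion_compose[OF G]) (intro fps_expansion_intros, simp)
  then have "(\<lambda>z. eval_fps G (of_real Q * z)) has_fps_expansion
      (G oo (fps_const (of_real Q) * fps_X))"
    by (simp add: o_def)
  then have "(\<lambda>z. (1 - z) * eval_fps G (of_real Q * z)) has_fps_expansion
      (1 - fps_X) * (G oo (fps_const (of_real Q) * fps_X))"
    by (intro has_fps_expansion_mult fps_expansion_intros)
  moreover have "(\<lambda>z. (1 - of_real c * z) * eval_fps G z) has_fps_expansion
      (1 - fps_const (of_real c) * fps_X) * G"
    by (intro fps_expansion_intros G)
  moreover have "(1 - fps_const (of_real c) * fps_X) * G
      = (1 - fps_X) * (G oo (fps_const (of_real Q) * fps_X))"
  proof (rule fps_ext)
    fix n
    show "fps_nth ((1 - fps_const (of_real c) * fps_X) * G) n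
        = fps_nth ((1 - fps_X) * (G oo (fps_const (of_real Q) * fps_X))) n"
    proof (cases n)
      case (Suc m)
      \<comment> \<open>Multiplied by its nonzero denominator, the recursion is exactly the
        comparison of coefficients in degree m + 1.\<close>
      have "Q ^ Suc m < 1"
        using Q by (intro power_Suc_less_one) auto
      then have "complex_of_real (1 - Q ^ Suc m) \<noteq> 0"
        by (simp only: of_real_eq_0_iff)
      then have "of_real (1 - Q ^ Suc m) * a (Suc m) = of_real (c - Q ^ m) * a m"
        unfolding aS of_real_divide by (simp del: of_real_diff power_Suc)
      then show ?thesis
        unfolding left_diff_distrib mult_1 fps_sub_nth mult.assoc fps_nth_compose_linear Suc
        by (simp add: G_def) (simp add: algebra_simps)
    qed (simp add: G_def)
  qed
  ultimately have "eventually (\<lambda>z. (1 - of_real c * z) * eval_fps G z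
      = (1 - z) * eval_fps G (of_real Q * z)) (nhds 0)"
    unfolding has_fps_expansion_def by (auto elim: eventually_elim2)
  moreover have "eventually (\<lambda>z. eval_fps G z \<noteq> 0) (nhds 0)"
  proof -
    have "isCont (eval_fps G) 0"
      using has_fps_expansion_imp_continuous[OF G, of UNIV] by simp
    moreover have "eval_fps G 0 \<noteq> 0"
      by (simp add: eval_fps_at_0 G_def a0)
    ultimately show ?thesis
      using continuous_at_avoid[of 0 "eval_fps G" 0]
      by (auto simp: eventually_nhds_metric dist_commute)
  qed
  moreover have "eventually (\<lambda>z. z \<in> S) (nhds 0)"
    using S by (intro eventually_nhds_in_open)
  ultimately have "eventually (\<lambda>z. ((1 - of_real c * z) * eval_fps G z
      = (1 - z) * eval_fps G (of_real Q * z)) \<and> eval_fps G z \<noteq> 0 \<and> z \<in> S) (nhds 0)"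
    by (auto intro: eventually_conj)
  then obtain d where "d > 0" and d: "\<And>z. dist z 0 < d \<Longrightarrow>
      ((1 - of_real c * z) * eval_fps G z = (1 - z) * eval_fps G (of_real Q * z))
        \<and> eval_fps G z \<noteq> 0 \<and> z \<in> S"
    unfolding eventually_nhds_metric by blast
  show ?thesis
  \<comment> \<open>The cap at 1 provides \<open>r \<le> 1\<close>, which later keeps z^m inside the
    disc.\<close>
  proof (rule that[of "min d 1" "eval_fps G"])
    show "eval_fps G holomorphic_on ball 0 (min d 1)"
      by (rule holomorphic_on_subset[OF S(3)]) (use d in auto)
  qed (use d \<open>d > 0\<close> in \<open>auto simp: eval_fps_at_0 G_def a0\<close>)
qed

text \<open>
  With \<open>F(z) = z g(z\<^sup>m)\<close> the equation \<open>F(q z) = (1 - (1 - q) p(z\<^sup>m)) F(z)\<close> for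
  \<open>p(x) = (1 + x) / (1 - x)\<close> becomes \<open>(1 - c z\<^sup>m) g(z\<^sup>m) = (1 - z\<^sup>m) g(q\<^sup>m z\<^sup>m)\<close>.
\<close>
lemma q_quot_solution_exists:
  assumes q: "0 < q" "q < 1" and m: "m > 0"
  shows "\<exists>r\<in>{0<..1}. \<exists>F. q_quot_solution q r (\<lambda>z. (1 + z ^ m) / (1 - z ^ m)) F"
proof -
  \<comment> \<open>Chosen so that 1 - (1 - q) (1 + x) / (1 - x) = q (1 - c x) / (1 - x).\<close>
  define c where "c = (2 - q) / q"
  have "0 < q ^ m" "q ^ m < 1" "c \<ge> 0"
    using q m by (auto simp: c_def power_less_one_iff)
  then obtain r g where r: "0 < r" "r \<le> 1" and hol: "g holomorphic_on ball 0 r" and "g 0 = 1"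
    and nz: "\<And>z. z \<in> ball 0 r \<Longrightarrow> g z \<noteq> 0"
    and eq: "\<And>z. z \<in> ball 0 r
      \<Longrightarrow> (1 - of_real c * z) * g z = (1 - z) * g (of_real (q ^ m) * z)"
    using q_binomial_functional_equation by metis
  have ball: "z ^ m \<in> ball 0 r" if "z \<in> ball 0 r" for z :: complex
  proof -
    have "cmod z ^ m \<le> cmod z ^ 1"
      using that r m by (intro power_decreasing) auto
    then show ?thesis
      using that by (simp add: norm_power)
  qed
  define F where "F z = z * g (z ^ m)" for z
  have holg: "(\<lambda>z. g (z ^ m)) holomorphic_on ball 0 r"
    using holomorphic_on_compose_gen[of "\<lambda>z. z ^ m" "ball 0 r" g "ball 0 r"] hol ball
    by (simp add: o_def image_subset_iff holomorphic_intros)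
  have "F holomorphic_on ball 0 r"
    unfolding F_def by (intro holomorphic_intros holg)
  moreover have "F 0 = 0"
    by (simp add: F_def)
  moreover have "deriv F 0 = 1"
  proof -
    have "((\<lambda>z. g (z ^ m)) has_field_derivative deriv (\<lambda>z. g (z ^ m)) 0) (at 0)"
      using holg r by (intro holomorphic_derivI[of _ "ball 0 r"]) auto
    then have "(F has_field_derivative 1) (at 0)"
      unfolding F_def using m \<open>g 0 = 1\<close> by (auto intro!: derivative_eq_intros simp: power_0_left)
    then show ?thesis
      by (rule DERIV_imp_deriv)
  qed
  moreover have "q_quot q F z = (1 + z ^ m) / (1 - z ^ m)" if z: "z \<in> ball 0 r" for z
  proof (cases "z = 0")
    case True
    then show ?thesis
      using m by (simp add: q_quot_def power_0_left)
  next
    case False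
    define u v x where "u = g (z ^ m)" and "v = g ((of_real q * z) ^ m)" and "x = z ^ m"
    have "u \<noteq> 0"
      using nz[OF ball[OF z]] by (simp add: u_def)
    have "cmod x < 1"
      using ball[OF z] r by (simp add: x_def)
    then have x: "1 - x \<noteq> 0"
      by auto
    have Q: "complex_of_real q \<noteq> 0" "1 - complex_of_real q \<noteq> 0"
      using q by auto
    have "(1 - of_real c * x) * u = (1 - x) * v"
      using eq[OF ball[OF z]] by (simp add: u_def v_def x_def power_mult_distrib)
    moreover have "of_real q * of_real c = (2 - of_real q :: complex)"
      using q by (simp add: c_def)
    ultimately have *: "(of_real q - (2 - of_real q) * x) * u = of_real q * (1 - x) * v"
      by algebra
    have "q_quot q F z = (u - of_real q * v) / ((1 - of_real q) * u)"
      using False \<open>u \<noteq> 0\<close> Q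
      by (simp add: q_quot_def q_diff_def F_def flip: u_def v_def)
        (simp add: divide_simps, simp add: algebra_simps)
    also have "\<dots> = (1 + x) / (1 - x)"
    proof -
      have "(u - of_real q * v) * (1 - x) = (1 + x) * ((1 - of_real q) * u)"
        using * by algebra
      then show ?thesis
        using \<open>u \<noteq> 0\<close> Q x by (simp add: frac_eq_eq)
    qed
    finally show ?thesis
      by (simp add: x_def)
  qed
  ultimately show ?thesis
    using r unfolding q_quot_solution_def normalized_on_def
    by (intro bexI[of _ r] exI[of _ F]) auto
qed

section \<open>The bound and the two equality cases\<close>

theorem theorem3p5:
  fixes q :: real and f :: "complex \<Rightarrow> complex" and \<mu> :: complex
  assumes "0 < q" and "q < 1" and "f \<in> class_S q"
  shows
    "cmod (taylor_coeff f 3 - \<mu> * (taylor_coeff f 2)\<^sup>2)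
       \<le> max (cmod ((2 * (2 + of_real q) - 4 * \<mu> * (1 + of_real q)) /
                      (of_real q ^ 2 * (1 + of_real q))))
             (2 / (q * (1 + q)))
     \<and> (\<forall>r\<in>{0<..1}. \<forall>F. q_quot_solution q r (\<lambda>z. (1 + z) / (1 - z)) F \<longrightarrow>
          cmod (taylor_coeff F 3 - \<mu> * (taylor_coeff F 2)\<^sup>2)
            = cmod ((2 * (2 + of_real q) - 4 * \<mu> * (1 + of_real q)) /
                      (of_real q ^ 2 * (1 + of_real q))))
     \<and> (\<forall>r\<in>{0<..1}. \<forall>G. q_quot_solution q r (\<lambda>z. (1 + z\<^sup>2) / (1 - z\<^sup>2)) G \<longrightarrow>
          cmod (taylor_coeff G 3 - \<mu> * (taylor_coeff G 2)\<^sup>2) = 2 / (q * (1 + q)))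
     \<and> (\<exists>r\<in>{0<..1}. \<exists>F. q_quot_solution q r (\<lambda>z. (1 + z) / (1 - z)) F)
     \<and> (\<exists>r\<in>{0<..1}. \<exists>G. q_quot_solution q r (\<lambda>z. (1 + z\<^sup>2) / (1 - z\<^sup>2)) G)"
proof (intro conjI ballI allI impI)
  \<comment> \<open>Each \<open>f\<close> in the class solves the equation given by its own quotient
    on the unit disc, so the general coefficient formulas apply with \<open>r = 1\<close>.\<close>
  have sol: "q_quot_solution q 1 (q_quot q f) f" and pos: "\<And>z. z \<in> ball 0 1 \<Longrightarrow> Re (q_quot q f z) > 0"
    using assms(3) by (auto simp: class_S_def class_A_def q_quot_solution_def)
  have hol: "q_quot q f holomorphic_on ball 0 1"
    using q_quot_holomorphic[OF assms] .
  have P: "q_quot q f has_fps_expansion fps_expansion (q_quot q f) 0"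
    using hol by (intro has_fps_expansion_fps_expansion[of "ball 0 1"]) auto
  have nz: "\<forall>z\<in>ball 0 1. q_quot q f z \<noteq> 0"
    using pos by force
  note FS = q_quot_Fekete_Szego[OF assms(1,2) zero_less_one sol nz P, of \<mu>]
  define \<nu> where "\<nu> = (\<mu> * (1 + of_real q) - 1) / of_real q"
  have "cmod (taylor_coeff f 3 - \<mu> * (taylor_coeff f 2)\<^sup>2)
      \<le> 2 * max 1 (cmod (2 * \<nu> - 1)) / (q * (1 + q))"
    unfolding FS(1) \<nu>_def using assms(1,2) pos
    by (intro divide_right_mono Fekete_Szego_positive_real_part[OF hol _ _ P])
      (auto simp: q_quot_def)
  also have "\<dots> = max (2 * cmod (2 * \<nu> - 1) / (q * (1 + q))) (2 / (q * (1 + q)))"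
  proof -
    have "q * (1 + q) > 0"
      using assms(1) by simp
    then show ?thesis
      by (auto simp: max_def divide_le_cancel)
  qed
  also have "2 * cmod (2 * \<nu> - 1) / (q * (1 + q))
      = cmod ((2 * (2 + of_real q) - 4 * \<mu> * (1 + of_real q)) /
                (of_real q ^ 2 * (1 + of_real q)))"
    unfolding \<nu>_def by (rule FS(2))
  finally show "cmod (taylor_coeff f 3 - \<mu> * (taylor_coeff f 2)\<^sup>2)
       \<le> max (cmod ((2 * (2 + of_real q) - 4 * \<mu> * (1 + of_real q)) /
                      (of_real q ^ 2 * (1 + of_real q))))
             (2 / (q * (1 + q)))" .
next
  fix r F
  assume r: "r \<in> {0<..1 :: real}" and F: "q_quot_solution q r (\<lambda>z. (1 + z) / (1 - z)) F"
  obtain P where P: "(\<lambda>z :: complex. (1 + z) / (1 - z)) has_fps_expansion P"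
      and eq: "(1 - fps_X) * P = 1 + fps_X"
    by (rule fps_expansion_of_quotient_eq[of "\<lambda>z. 1 + z" "1 + fps_X" "\<lambda>z. 1 - z" "1 - fps_X"])
      (auto intro!: fps_expansion_intros)
  have P0: "fps_nth P 0 = 1"
    using arg_cong[OF eq, of "\<lambda>F. fps_nth F 0"] by simp
  have P1: "fps_nth P 1 = 2"
    using arg_cong[OF eq, of "\<lambda>F. fps_nth F 1"] P0 by (simp add: algebra_simps)
  have P2: "fps_nth P 2 = 2"
    using arg_cong[OF eq, of "\<lambda>F. fps_nth F 2"] P1 by (simp add: algebra_simps)
  \<comment> \<open>Besides the zero -1, the pole 1 has to be avoided, since HOL assigns the value 0
    there; \<open>r \<le> 1\<close> excludes both.\<close>
  have nz: "\<forall>z\<in>ball 0 r. (1 + z) / (1 - z) \<noteq> (0 :: complex)"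
  proof
    fix z :: complex
    assume z: "z \<in> ball 0 r"
    have "cmod z < 1"
      using z r by auto
    then have "z \<noteq> 1" "z \<noteq> - 1"
      by auto
    then show "(1 + z) / (1 - z) \<noteq> 0"
      by (simp add: add_eq_0_iff)
  qed
  have "r > 0"
    using r by simp
  note FS = q_quot_Fekete_Szego[OF assms(1,2) this F nz P, of \<mu>]
  \<comment> \<open>The coefficients 2 and 2 thus attain the first entry of the maximum.\<close>
  have "2 - \<nu> * 2\<^sup>2 = (- 2) * (2 * \<nu> - 1)" for \<nu> :: complex
    by (simp add: algebra_simps)
  then have key: "cmod (2 - \<nu> * 2\<^sup>2) = 2 * cmod (2 * \<nu> - 1)" for \<nu> :: complex
    by (simp only: norm_mult) simp
  show "cmod (taylor_coeff F 3 - \<mu> * (taylor_coeff F 2)\<^sup>2)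
      = cmod ((2 * (2 + of_real q) - 4 * \<mu> * (1 + of_real q)) /
                (of_real q ^ 2 * (1 + of_real q)))"
    unfolding FS(1) FS(2)[symmetric] P1 P2 key by simp
next
  fix r G
  assume r: "r \<in> {0<..1 :: real}" and G: "q_quot_solution q r (\<lambda>z. (1 + z\<^sup>2) / (1 - z\<^sup>2)) G"
  obtain P where P: "(\<lambda>z :: complex. (1 + z\<^sup>2) / (1 - z\<^sup>2)) has_fps_expansion P"
      and eq: "(1 - fps_X\<^sup>2) * P = 1 + fps_X\<^sup>2"
    by (rule fps_expansion_of_quotient_eq[of "\<lambda>z. 1 + z\<^sup>2" "1 + fps_X\<^sup>2" "\<lambda>z. 1 - z\<^sup>2" "1 - fps_X\<^sup>2"])
      (auto intro!: fps_expansion_intros)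
  have P0: "fps_nth P 0 = 1"
    using arg_cong[OF eq, of "\<lambda>F. fps_nth F 0"] by simp
  \<comment> \<open>The series is even, so the term with \<nu> drops out and the value does not
    depend on \<mu>.\<close>
  have P1: "fps_nth P 1 = 0"
    using arg_cong[OF eq, of "\<lambda>F. fps_nth F 1"] by (simp add: algebra_simps fps_X_power_mult_nth)
  have P2: "fps_nth P 2 = 2"
    using arg_cong[OF eq, of "\<lambda>F. fps_nth F 2"] P0
    by (simp add: left_diff_distrib fps_X_power_mult_nth)
  have nz: "\<forall>z\<in>ball 0 r. (1 + z\<^sup>2) / (1 - z\<^sup>2) \<noteq> (0 :: complex)"
  proof
    fix z :: complex
    assume z: "z \<in> ball 0 r"
    have "cmod (z\<^sup>2) < 1"
      using z r by (auto simp: norm_power power_less_one_iff)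
    then have "z\<^sup>2 \<noteq> 1" "z\<^sup>2 \<noteq> - 1"
      by (metis norm_one order_less_irrefl, metis norm_minus_cancel norm_one order_less_irrefl)
    then show "(1 + z\<^sup>2) / (1 - z\<^sup>2) \<noteq> 0"
      by (simp add: add_eq_0_iff)
  qed
  have "r > 0"
    using r by simp
  note FS = q_quot_Fekete_Szego[OF assms(1,2) this G nz P, of \<mu>]
  show "cmod (taylor_coeff G 3 - \<mu> * (taylor_coeff G 2)\<^sup>2) = 2 / (q * (1 + q))"
    unfolding FS(1) P1 P2 by simp
next
  show "\<exists>r\<in>{0<..1}. \<exists>F. q_quot_solution q r (\<lambda>z. (1 + z) / (1 - z)) F"
    using q_quot_solution_exists[OF assms(1,2), of 1] by simp
  show "\<exists>r\<in>{0<..1}. \<exists>G. q_quot_solution q r (\<lambda>z. (1 + z\<^sup>2) / (1 - z\<^sup>2)) G"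
    using q_quot_solution_exists[OF assms(1,2), of 2] by simp
qed

end
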